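(* Let $A$ and $B$ be nonempty finite subsets of an abelian group $G$, with $|A| = |B|$ and $1 \notin B$. Let $0 \leq d \leq |B|$ be an integer. Assume that $B$ is a $d$-defective Chowla set. Then there exists a partial matching of $(A,B)$ with defect $d$.
   Context: The group $G$ is written multiplicatively with identity $1$. The order of $x \in G$ is denoted $o(x)$ (possibly infinite). For a nonnegative integer $d$, a nonempty finite subset $B$ of a group $G$ is called a $d$-defective Chowla set if there exists $B_0 \subseteq B$ with $|B_0| \geq |B| - d$ such that $o(x) > |B|$ for every $x \in B_0$. For nonempty finite $A,B \subseteq G$ with $|A|=|B|$, a partial matching of $(A,B)$ with defect $d$ is an injective map $f : A' \to B$, where $A' \subseteq A$ and $|A \setminus A'| = d$, such that $a f(a) \notin A$ for all $a \in A'$. The empty map (with $A' = \emptyset$) is allowed. *)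

theory Defs
  imports "HOL-Algebra.Multiplicative_Group" "HOL-Library.Extended_Nat"
begin

text \<open>The library's \<^const>\<open>group.ord\<close> is \<open>0\<close> on elements of infinite order. The comparison
  \<open>o(x) > |B|\<close> needs such elements to have order \<open>\<infinity>\<close>.\<close>

definition elem_order :: "('a, 'b) monoid_scheme \<Rightarrow> 'a \<Rightarrow> enat" where
  "elem_order G x = (if group.ord G x = 0 then \<infinity> else enat (group.ord G x))"

text \<open>The bound \<open>|B\<^sub>0| \<ge> |B| - d\<close> is written additively, avoiding subtraction on \<^typ>\<open>nat\<close>.\<close>

definition defective_Chowla_set :: "('a, 'b) monoid_scheme \<Rightarrow> nat \<Rightarrow> 'a set \<Rightarrow> bool" where
  "defective_Chowla_set G d B \<longleftrightarrow>
     B \<subseteq> carrier G \<and> finite B \<and> B \<noteq> {} \<and>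
     (\<exists>B0 \<subseteq> B. card B \<le> card B0 + d \<and> (\<forall>x \<in> B0. enat (card B) < elem_order G x))"

text \<open>The matching is the restriction of \<open>f\<close> to \<open>A'\<close>; values of \<open>f\<close> outside \<open>A'\<close> are irrelevant.\<close>

definition partial_matching ::
  "('a, 'b) monoid_scheme \<Rightarrow> 'a set \<Rightarrow> 'a set \<Rightarrow> nat \<Rightarrow> 'a set \<Rightarrow> ('a \<Rightarrow> 'a) \<Rightarrow> bool" where
  "partial_matching G A B d A' f \<longleftrightarrow>
     A \<subseteq> carrier G \<and> finite A \<and> A \<noteq> {} \<and> B \<subseteq> carrier G \<and> finite B \<and> B \<noteq> {} \<and> card A = card B \<and>
     A' \<subseteq> A \<and> card (A - A') = d \<and> f \<in> A' \<rightarrow> B \<and> inj_on f A' \<and>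
     (\<forall>a \<in> A'. a \<otimes>\<^bsub>G\<^esub> f a \<notin> A)"

end

theory Submission
  imports Defs
begin

text \<open>By the defect form of Hall's theorem it suffices that every nonempty \<open>S \<subseteq> A\<close> satisfies
  \<open>|S| + |V| \<le> |B| + d\<close>, where \<open>V\<close> is the set of those \<open>b \<in> B\<close> with \<open>S b \<subseteq> A\<close>. At most \<open>d\<close>
  elements of \<open>V\<close> have order at most \<open>|B|\<close>; for the set \<open>U\<close> of the others \<open>S (U \<union> {1}) \<subseteq> A\<close>, so
  Chowla's theorem gives \<open>|S| + |U| \<le> |A|\<close>. Chowla's theorem itself follows by induction on the
  second factor with Dyson's transform.\<close>

section \<open>Hall's theorem with a defect\<close>

text \<open>Rado's proof of Hall's theorem: the condition survives the deletion of one of any two elements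
  of a set of the family, because \<open>S \<mapsto> card (\<Union>(N ` S))\<close> is submodular.\<close>

lemma defect_Hall_remove:
  assumes fin: "finite A" "\<And>a. a \<in> A \<Longrightarrow> finite (N a)"
    and Hall: "\<And>S. S \<subseteq> A \<Longrightarrow> card S \<le> card (\<Union>(N ` S)) + d"
    and a: "a \<in> A" "x \<in> N a" "y \<in> N a" "x \<noteq> y"
  shows "(\<forall>S\<subseteq>A. card S \<le> card (\<Union>((N(a := N a - {x})) ` S)) + d) \<or>
         (\<forall>S\<subseteq>A. card S \<le> card (\<Union>((N(a := N a - {y})) ` S)) + d)"
proof (rule ccontr)
  \<comment> \<open>A set violating the condition after the deletion must contain \<open>a\<close>,
    since otherwise its neighbourhood is unchanged. Dropping \<open>a\<close> from it turns the
    strict inequality into a weak one.\<close>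
  have violation: "\<exists>S\<subseteq>A - {a}. card (\<Union>(N ` S) \<union> (N a - {z})) + d \<le> card S"
    if fails: "\<not> (\<forall>S\<subseteq>A. card S \<le> card (\<Union>((N(a := N a - {z})) ` S)) + d)" for z
  proof -
    obtain S where S: "S \<subseteq> A" "card (\<Union>((N(a := N a - {z})) ` S)) + d < card S"
      using fails by (meson not_le)
    have "a \<in> S"
    proof (rule ccontr)
      assume "a \<notin> S"
      then have "(N(a := N a - {z})) ` S = N ` S"
        by (intro image_cong) auto
      then have "card (\<Union>((N(a := N a - {z})) ` S)) = card (\<Union>(N ` S))"
        by (rule arg_cong)
      with Hall[OF S(1)] S(2) show False by linarith
    qed
    have "\<Union>((N(a := N a - {z})) ` S) = \<Union>(N ` (S - {a})) \<union> (N a - {z})"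
      using \<open>a \<in> S\<close> by (auto split: if_splits)
    moreover have "card S = Suc (card (S - {a}))"
      using \<open>a \<in> S\<close> S(1) fin(1) by (metis card_Suc_Diff1 finite_subset)
    ultimately have "card (\<Union>(N ` (S - {a})) \<union> (N a - {z})) + d \<le> card (S - {a})"
      using S(2) by (simp only: less_Suc_eq_le)
    moreover have "S - {a} \<subseteq> A - {a}"
      using S(1) by blast
    ultimately show ?thesis by blast
  qed
  assume "\<not> ?thesis"
  then have "\<exists>S\<subseteq>A - {a}. card (\<Union>(N ` S) \<union> (N a - {x})) + d \<le> card S"
    "\<exists>T\<subseteq>A - {a}. card (\<Union>(N ` T) \<union> (N a - {y})) + d \<le> card T"
    by (intro violation; simp only: de_Morgan_disj)+
  then obtain S T where
    S: "S \<subseteq> A - {a}" "card (\<Union>(N ` S) \<union> (N a - {x})) + d \<le> card S" and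
    T: "T \<subseteq> A - {a}" "card (\<Union>(N ` T) \<union> (N a - {y})) + d \<le> card T"
    by blast
  let ?X = "\<Union>(N ` S) \<union> (N a - {x})" and ?Y = "\<Union>(N ` T) \<union> (N a - {y})"
  have finST: "finite S" "finite T"
    using S(1) T(1) fin(1) by (auto intro: finite_subset)
  have finXY: "finite ?X" "finite ?Y"
    using S(1) T(1) a(1) finST by (auto intro!: fin(2))
  \<comment> \<open>As \<open>x \<noteq> y\<close>, each deletion restores what the other removes,
    so together they give all of \<open>N a\<close>.\<close>
  have "?X \<union> ?Y = \<Union>(N ` insert a (S \<union> T))"
    using a by auto
  moreover have "card (insert a (S \<union> T)) \<le> card (\<Union>(N ` insert a (S \<union> T))) + d"
    using S(1) T(1) a(1) by (intro Hall) auto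
  moreover have "card (insert a (S \<union> T)) = Suc (card (S \<union> T))"
    using S(1) T(1) finST by (intro card_insert_disjoint) auto
  \<comment> \<open>The element \<open>a\<close> counts only on the union side. This extra one
    contradicts the sum of the two violations.\<close>
  ultimately have "Suc (card (S \<union> T)) \<le> card (?X \<union> ?Y) + d" by simp
  moreover have "card (S \<inter> T) \<le> card (?X \<inter> ?Y) + d"
  proof -
    have "card (S \<inter> T) \<le> card (\<Union>(N ` (S \<inter> T))) + d"
      using S(1) by (intro Hall) auto
    also have "card (\<Union>(N ` (S \<inter> T))) \<le> card (?X \<inter> ?Y)"
      using finXY by (intro card_mono) auto
    finally show ?thesis by simp
  qed
  moreover have "card ?X + card ?Y = card (?X \<union> ?Y) + card (?X \<inter> ?Y)"
    using card_Un_Int[OF finXY] .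
  moreover have "card S + card T = card (S \<union> T) + card (S \<inter> T)"
    using card_Un_Int[OF finST] .
  ultimately show False using S(2) T(2) by linarith
qed

text \<open>Deletions preserving the condition lower the total size of the \<open>N a\<close> until
  each has at most one element; then a matching can be read off.\<close>

lemma defect_Hall:
  assumes "finite A" "\<And>a. a \<in> A \<Longrightarrow> finite (N a)"
    and "\<And>S. S \<subseteq> A \<Longrightarrow> card S \<le> card (\<Union>(N ` S)) + d"
    and "d \<le> card A"
  shows "\<exists>A' f. A' \<subseteq> A \<and> card (A - A') = d \<and> (\<forall>a\<in>A'. f a \<in> N a) \<and> inj_on f A'"
  using assms(2,3)
proof (induction "\<Sum>a\<in>A. card (N a)" arbitrary: N rule: less_induct)
  case less
  show ?case
  proof (cases "\<exists>a\<in>A. \<exists>x\<in>N a. \<exists>y\<in>N a. x \<noteq> y")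
    case True
    then obtain a x y where a: "a \<in> A" "x \<in> N a" "y \<in> N a" "x \<noteq> y" by blast
    obtain z where z: "z \<in> N a"
      and Hall: "\<And>S. S \<subseteq> A \<Longrightarrow> card S \<le> card (\<Union>((N(a := N a - {z})) ` S)) + d"
      using defect_Hall_remove[OF assms(1) less.prems a] a(2,3) by blast
    let ?N = "N(a := N a - {z})"
    have "card (?N b) \<le> card (N b)" if "b \<in> A" for b
      using less.prems(1)[OF that] by (auto intro: card_mono)
    moreover have "card (?N a) < card (N a)"
      using card_Diff1_less[OF less.prems(1)[OF a(1)] z] by simp
    ultimately have "(\<Sum>b\<in>A. card (?N b)) < (\<Sum>b\<in>A. card (N b))"
      using a(1) assms(1) by (intro sum_strict_mono_ex1) auto
    moreover have "finite (?N b)" if "b \<in> A" for b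
      using less.prems(1)[OF that] by auto
    ultimately have "\<exists>A' f. A' \<subseteq> A \<and> card (A - A') = d \<and> (\<forall>b\<in>A'. f b \<in> ?N b) \<and> inj_on f A'"
      using Hall by (rule less.hyps)
    then obtain A' f where Af: "A' \<subseteq> A" "card (A - A') = d" "\<forall>b\<in>A'. f b \<in> ?N b" "inj_on f A'"
      by blast
    have "\<forall>b\<in>A'. f b \<in> N b"
      using Af(3) by (auto split: if_splits)
    with Af show ?thesis by blast
  next
    case False
    \<comment> \<open>The condition for \<open>A\<close> itself supplies enough values. Choosing a
      source for each is injective, because no \<open>N a\<close> contains two of them.\<close>
    have "card A - d \<le> card (\<Union>(N ` A))"
      using less.prems(2)[of A] by simp
    then obtain R where R: "R \<subseteq> \<Union>(N ` A)" "card R = card A - d"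
      by (meson obtain_subset_with_card_n)
    then have "\<forall>r\<in>R. \<exists>a\<in>A. r \<in> N a" by blast
    then obtain g where g: "\<And>r. r \<in> R \<Longrightarrow> g r \<in> A \<and> r \<in> N (g r)" by metis
    have inj: "inj_on g R"
      using g False by (metis inj_onI)
    have sub: "g ` R \<subseteq> A" using g by auto
    \<comment> \<open>Here \<open>d \<le> card A\<close> makes the truncated difference
      \<open>card A - d\<close> exact.\<close>
    have "card (A - g ` R) = d"
      using sub R(2) assms(1,4) card_image[OF inj] by (simp add: card_Diff_subset finite_subset)
    moreover have "\<forall>a\<in>g ` R. inv_into R g a \<in> N a"
      using g inj by auto
    ultimately show ?thesis
      using sub inj_on_inv_into[of "g ` R" g R] by blast
  qed
qed

section \<open>Chowla's theorem in abelian groups\<close>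

context comm_group
begin

text \<open>Starting from any \<open>s\<close> in \<open>S\<close>, the elements
  \<open>s \<otimes> u [^] k\<close> stay in \<open>S\<close>, so they must repeat early.\<close>

lemma elem_order_le_card_if_mult_closed:
  assumes S: "S \<subseteq> carrier G" "finite S" "S \<noteq> {}"
    and u: "u \<in> carrier G" and closed: "\<And>s. s \<in> S \<Longrightarrow> s \<otimes> u \<in> S"
  shows "elem_order G u \<le> enat (card S)"
proof (rule ccontr)
  assume "\<not> ?thesis"
  then have ord: "ord u = 0 \<or> card S < ord u"
    by (auto simp: elem_order_def split: if_splits)
  obtain s where s: "s \<in> S" using S(3) by blast
  have "s \<otimes> u [^] (k::nat) \<in> S" for k
  proof (induction k)
    case 0
    then show ?case using s S(1) by auto
  next
    case (Suc k)
    then show ?case using closed[OF Suc] s S(1) u by (auto simp: m_assoc)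
  qed
  \<comment> \<open>The exponents from 0 to \<open>card S\<close> are one more than \<open>S\<close>
    can hold.\<close>
  moreover have "inj_on (\<lambda>k::nat. s \<otimes> u [^] k) {..card S}"
  proof (rule linorder_inj_onI)
    fix i j :: nat
    assume ij: "i < j" "i \<in> {..card S}" "j \<in> {..card S}"
    show "s \<otimes> u [^] i \<noteq> s \<otimes> u [^] j"
    proof
      assume "s \<otimes> u [^] i = s \<otimes> u [^] j"
      then have "u [^] i = u [^] j"
        using s S(1) u Units_l_cancel[of s "u [^] i" "u [^] j"] by auto
      also have "\<dots> = u [^] i \<otimes> u [^] (j - i)"
        using ij(1) u by (simp add: nat_pow_mult)
      finally have "u [^] (j - i) = \<one>"
        using u by (metis l_cancel_one' nat_pow_closed)
      then have "ord u dvd j - i"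
        using u pow_eq_id by blast
      then have "ord u \<noteq> 0" "ord u \<le> j - i"
        using ij(1) by (auto dest: dvd_imp_le intro!: Nat.gr0I)
      then show False using ord ij by auto
    qed
  qed auto
  ultimately have "card {..card S} \<le> card S"
    using S(2) by (intro card_inj_on_le) auto
  then show False by simp
qed

text \<open>Dyson's transform shrinks \<open>U\<close>, keeps the sum of the two sizes and does not
  enlarge the product set. Since orders are compared with the size of the product set, the
  hypothesis passes to the new pair.\<close>

lemma Chowla:
  assumes "S \<subseteq> carrier G" "finite S" "S \<noteq> {}"
    and "U \<subseteq> carrier G" "finite U" "\<one> \<in> U"
    and "\<And>u. u \<in> U \<Longrightarrow> u \<noteq> \<one> \<Longrightarrow> enat (card (S <#> U)) < elem_order G u"
  shows "card S + card U \<le> Suc (card (S <#> U))"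
  using assms
proof (induction "card U" arbitrary: S U rule: less_induct)
  case less
  note S = less.prems(1-3) and U = less.prems(4-6) and ord = less.prems(7)
  have fin: "finite (S <#> U)"
    using S(2) U(2) by (auto simp: set_mult_def)
  have S_sub: "S \<subseteq> S <#> U"
    using S(1) U(3) by (force simp: set_mult_def)
  show ?case
  proof (cases "U = {\<one>}")
    case True
    then show ?thesis using card_mono[OF fin S_sub] by simp
  next
    case False
    then obtain u where u: "u \<in> U" "u \<noteq> \<one>" using U(3) by blast
    \<comment> \<open>The order of \<open>u\<close> is too large for \<open>S\<close> to be closed
      under multiplication by \<open>u\<close>.\<close>
    have "\<not> (\<forall>s\<in>S. s \<otimes> u \<in> S)"
    proof
      assume "\<forall>s\<in>S. s \<otimes> u \<in> S"
      then have "elem_order G u \<le> enat (card S)"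
        using S U(1) u(1) by (intro elem_order_le_card_if_mult_closed) auto
      also have "\<dots> \<le> enat (card (S <#> U))"
        using card_mono[OF fin S_sub] by simp
      finally show False using ord[OF u] by simp
    qed
    then obtain s where s: "s \<in> S" "s \<otimes> u \<notin> S" by blast
    have sG: "s \<in> carrier G" using s S by blast
    \<comment> \<open>Dyson's transform at \<open>s\<close>: \<open>U'\<close> keeps
      \<open>\<one>\<close> because \<open>s\<close> lies in \<open>S\<close>, and loses
      \<open>u\<close> because \<open>s \<otimes> u\<close> does not.\<close>
    define S' where "S' = S \<union> (\<otimes>) s ` U"
    define U' where "U' = {v \<in> U. s \<otimes> v \<in> S}"
    have S': "S' \<subseteq> carrier G" "finite S'" "S' \<noteq> {}"
      using S U sG by (auto simp: S'_def)
    have U': "U' \<subseteq> carrier G" "finite U'" "\<one> \<in> U'"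
      using U s(1) sG by (auto simp: U'_def)
    have less_U: "card U' < card U"
      using u s U(2) by (intro psubset_card_mono) (auto simp: U'_def)
    have sub: "S' <#> U' \<subseteq> S <#> U"
    proof -
      \<comment> \<open>Commutativity matters here: for \<open>v\<close> in \<open>U'\<close> the
        factor \<open>s \<otimes> v\<close> lies in \<open>S\<close>, so the product is again in
        \<open>S <#> U\<close>.\<close>
      have "(s \<otimes> w) \<otimes> v = (s \<otimes> v) \<otimes> w" if "v \<in> U" "w \<in> U" for v w
        using that U(1) sG by (metis m_assoc m_comm subsetD)
      then show ?thesis
        unfolding set_mult_def S'_def U'_def by fastforce
    qed
    then have le: "card (S' <#> U') \<le> card (S <#> U)"
      using fin by (rule card_mono[rotated])
    have "card S' + card U' \<le> Suc (card (S' <#> U'))"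
    proof (rule less.hyps[OF less_U S' U'])
      fix v assume "v \<in> U'" "v \<noteq> \<one>"
      then have "enat (card (S <#> U)) < elem_order G v"
        by (intro ord) (auto simp: U'_def)
      then show "enat (card (S' <#> U')) < elem_order G v"
        using le by (meson enat_ord_simps(1) le_less_trans)
    qed
    moreover have "card S' + card U' = card S + card U"
    proof -
      have inj: "inj_on ((\<otimes>) s) U"
        using inj_on_cmult[OF sG] U(1) by (rule inj_on_subset)
      \<comment> \<open>The part of the translate of \<open>U\<close> already in \<open>S\<close> is
        the translate of \<open>U'\<close>, so \<open>S\<close> gains as many elements as
        \<open>U\<close> loses.\<close>
      have "S \<inter> (\<otimes>) s ` U = (\<otimes>) s ` U'"
        by (auto simp: U'_def)
      moreover have "card ((\<otimes>) s ` U') = card U'"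
        using inj by (intro card_image inj_on_subset[OF inj]) (auto simp: U'_def)
      ultimately show ?thesis
        using card_Un_Int[of S "(\<otimes>) s ` U"] S(2) U(2) card_image[OF inj] by (simp add: S'_def)
    qed
    ultimately show ?thesis using le by linarith
  qed
qed

end

section \<open>Matchings from Chowla's theorem\<close>

theorem corollary3p8:
  fixes G (structure) and A B :: "'a set" and d :: nat
  assumes "comm_group G"
    and "A \<subseteq> carrier G" "finite A" "A \<noteq> {}"
    and "B \<subseteq> carrier G" "finite B" "B \<noteq> {}"
    and "card A = card B"
    and "\<one> \<notin> B"
    and "d \<le> card B"
    and "defective_Chowla_set G d B"
  shows "\<exists>A' f. partial_matching G A B d A' f"
proof -
  interpret comm_group G by fact
  obtain B0 where B0: "B0 \<subseteq> B" "card B \<le> card B0 + d"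
    and ord: "\<And>x. x \<in> B0 \<Longrightarrow> enat (card B) < elem_order G x"
    using assms(11) unfolding defective_Chowla_set_def by blast
  \<comment> \<open>The admissible partners of \<open>a\<close>.\<close>
  define N where "N a = {b \<in> B. a \<otimes> b \<notin> A}" for a
  have "card S \<le> card (\<Union>(N ` S)) + d" if "S \<subseteq> A" for S
  proof (cases "S = {}")
    case False
    \<comment> \<open>The elements of large order that multiply all of \<open>S\<close> into
      \<open>A\<close>.\<close>
    define U where "U = B0 - \<Union>(N ` S)"
    have finU: "finite U"
      using B0(1) assms(6) by (auto simp: U_def intro: finite_subset)
    have finN: "finite (\<Union>(N ` S))"
      using assms(6) by (rule finite_subset[rotated]) (auto simp: N_def)
    have sub: "S <#> insert \<one> U \<subseteq> A"
    proof -
      have "s \<otimes> u \<in> A" if "s \<in> S" "u \<in> U" for s u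
        using that B0(1) by (auto simp: U_def N_def)
      moreover have "s \<otimes> \<one> \<in> A" if "s \<in> S" for s
        using that \<open>S \<subseteq> A\<close> subsetD[OF assms(2), of s] by auto
      ultimately show ?thesis
        by (auto simp: set_mult_def)
    qed
    have le: "card (S <#> insert \<one> U) \<le> card B"
      using card_mono[OF assms(3) sub] assms(8) by simp
    have "card S + card (insert \<one> U) \<le> Suc (card (S <#> insert \<one> U))"
    proof (rule Chowla)
      fix u assume "u \<in> insert \<one> U" "u \<noteq> \<one>"
      then have "enat (card B) < elem_order G u"
        by (intro ord) (auto simp: U_def)
      then show "enat (card (S <#> insert \<one> U)) < elem_order G u"
        using le by (meson enat_ord_simps(1) le_less_trans)
    qed (use that False finU assms(2,3,5) B0(1) in \<open>auto simp: U_def intro: finite_subset\<close>)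
    \<comment> \<open>Since \<open>\<one> \<notin> B\<close>, adjoining \<open>\<one>\<close> adds
      exactly one element, cancelling the \<open>Suc\<close> in Chowla's bound.\<close>
    moreover have "card (insert \<one> U) = Suc (card U)"
      using assms(9) B0(1) finU by (intro card_insert_disjoint) (auto simp: U_def)
    moreover have "card B0 \<le> card U + card (\<Union>(N ` S))"
      using diff_card_le_card_Diff[OF finN, of B0] by (simp add: U_def)
    ultimately show ?thesis using le B0(2) by linarith
  qed simp
  moreover have "finite (N a)" for a
    using assms(6) by (simp add: N_def)
  ultimately obtain A' f where "A' \<subseteq> A" "card (A - A') = d" "\<forall>a\<in>A'. f a \<in> N a" "inj_on f A'"
    using defect_Hall[of A N d] assms(3,8,10) by auto
  then have "partial_matching G A B d A' f"
    using assms by (auto simp: partial_matching_def N_def)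
  then show ?thesis by blast
qed

end
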